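(* Let $\gamma_C\in(0,\frac1L]$. Consider the problem (P): minimize $E(\mathbf K,B)$ over real $\mathbf K=(K_0,\dots,K_N)\succ\mathbf 0$, $B>0$ subject to $T(\mathbf K,B)\le T_{\max}$ and $$\frac{c_1}{\gamma_CK_0\sum_{n\in\mathcal N}K_n}+c_2\gamma_C^2\max_{n\in\mathcal N}K_n^2+\frac{c_3\gamma_C}{B}+\frac{c_4\gamma_C\sum_{n\in\mathcal N}q_{s_0,s_n}K_n^2}{\sum_{n\in\mathcal N}K_n}\le C_{\max},$$ and the problem (P'): minimize $E(\mathbf K,B)$ over real $\mathbf K\succ\mathbf 0$, $B,T_1,T_2>0$ subject to $$\frac{C_n}{F_n}K_nT_1^{-1}\le1,\quad K_nT_2^{-1}\le1,\quad n\in\mathcal N,$$ $$\left(\frac{C_0}{F_0}+\max_{n\in\mathcal N}\frac{M_{s_n}}{r_n}+\frac{M_{s_0}}{r_0}+BT_1\right)\frac{K_0}{T_{\max}}\le1,$$ $$\frac{c_1}{\gamma_CK_0\sum_{n\in\mathcal N}K_n}+c_2\gamma_C^2T_2^2+\frac{c_3\gamma_C}{B}+\frac{c_4\gamma_C\sum_{n\in\mathcal N}q_{s_0,s_n}K_n^2}{\sum_{n\in\mathcal N}K_n}\le C_{\max}.$$ If $(\mathbf K^*,B^*,T_1^*,T_2^* )$ is an optimal point of (P'), then $(\mathbf K^*,B^* )$ is an optimal point of (P).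
   Context: $N\in\mathbb Z_+$, $\mathcal N=\{1,\dots,N\}$, $\bar{\mathcal N}=\{0\}\cup\mathcal N$. All of the following are given positive real constants: $L$; $C_n,F_n,\alpha_n,p_n,r_n,M_{s_n}$ ($n\in\bar{\mathcal N}$); $q_{s_0,s_n}$ ($n\in\mathcal N$); $c_1,c_2,c_3,c_4$; $T_{\max},C_{\max}$. For $\mathbf K=(K_0,\dots,K_N)\succ\mathbf 0$ (componentwise positive) and $B>0$: $$T(\mathbf K,B)=K_0\left(B\max_{n\in\mathcal N}\frac{C_n}{F_n}K_n+\frac{C_0}{F_0}+\max_{n\in\mathcal N}\frac{M_{s_n}}{r_n}+\frac{M_{s_0}}{r_0}\right),$$ $$E(\mathbf K,B)=K_0\left(B\sum_{n\in\mathcal N}\alpha_nC_nF_n^2K_n+\alpha_0C_0F_0^2+\sum_{n\in\bar{\mathcal N}}\frac{p_nM_{s_n}}{r_n}\right).$$ An optimal point is a feasible point attaining the minimum (global optimum). *)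

theory Defs
  imports Complex_Main "HOL-Library.FuncSet"
begin

text \<open>
  The given constants. Index 0 is the server and 1, ..., N are the workers; values of the
  indexed constants outside their index range are never used.
\<close>

record fl_params =
  pN :: nat
  pL :: real
  pC :: "nat \<Rightarrow> real"
  pF :: "nat \<Rightarrow> real"
  p\<alpha> :: "nat \<Rightarrow> real"
  pp :: "nat \<Rightarrow> real"
  pr :: "nat \<Rightarrow> real"
  pM :: "nat \<Rightarrow> real"    \<comment> \<open>\<open>pM P n\<close> is \<open>M\<close> with index \<open>s\<^sub>n\<close>\<close>
  pq :: "nat \<Rightarrow> real"    \<comment> \<open>\<open>pq P n\<close> is \<open>q\<close> with index pair \<open>s\<^sub>0, s\<^sub>n\<close>, for \<open>n \<ge> 1\<close>\<close>
  pc1 :: real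
  pc2 :: real
  pc3 :: real
  pc4 :: real
  pTmax :: real
  pCmax :: real

definition workers :: "fl_params \<Rightarrow> nat set" where
  "workers P = {1..pN P}"

definition nodes :: "fl_params \<Rightarrow> nat set" where
  "nodes P = {0..pN P}"

definition valid_params :: "fl_params \<Rightarrow> bool" where
  "valid_params P \<longleftrightarrow>
     0 < pN P \<and> 0 < pL P \<and>
     (\<forall>n\<in>nodes P. 0 < pC P n \<and> 0 < pF P n \<and> 0 < p\<alpha> P n \<and> 0 < pp P n \<and> 0 < pr P n \<and> 0 < pM P n) \<and>
     (\<forall>n\<in>workers P. 0 < pq P n) \<and>
     0 < pc1 P \<and> 0 < pc2 P \<and> 0 < pc3 P \<and> 0 < pc4 P \<and>
     0 < pTmax P \<and> 0 < pCmax P"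

text \<open>
  A vector \<open>(K\<^sub>0, \<dots>, K\<^sub>N)\<close> is an extensional function on the nodes (\<open>undefined\<close> elsewhere),
  so that these functions are in bijection with the positive \<open>(N+1)\<close>-tuples.
\<close>

definition positive_vectors :: "fl_params \<Rightarrow> (nat \<Rightarrow> real) set" where
  "positive_vectors P = nodes P \<rightarrow>\<^sub>E {0<..}"

definition time_cost :: "fl_params \<Rightarrow> (nat \<Rightarrow> real) \<Rightarrow> real \<Rightarrow> real" where
  "time_cost P K B =
     K 0 * (B * Max ((\<lambda>n. pC P n / pF P n * K n) ` workers P) + pC P 0 / pF P 0
            + Max ((\<lambda>n. pM P n / pr P n) ` workers P) + pM P 0 / pr P 0)"

definition energy_cost :: "fl_params \<Rightarrow> (nat \<Rightarrow> real) \<Rightarrow> real \<Rightarrow> real" where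
  "energy_cost P K B =
     K 0 * (B * (\<Sum>n\<in>workers P. p\<alpha> P n * pC P n * (pF P n)\<^sup>2 * K n)
            + p\<alpha> P 0 * pC P 0 * (pF P 0)\<^sup>2
            + (\<Sum>n\<in>nodes P. pp P n * pM P n / pr P n))"

definition feasible_P :: "fl_params \<Rightarrow> real \<Rightarrow> (nat \<Rightarrow> real) \<times> real \<Rightarrow> bool" where
  "feasible_P P \<gamma> = (\<lambda>(K, B).
     K \<in> positive_vectors P \<and> 0 < B \<and>
     time_cost P K B \<le> pTmax P \<and>
     pc1 P / (\<gamma> * K 0 * (\<Sum>n\<in>workers P. K n))
       + pc2 P * \<gamma>\<^sup>2 * Max ((\<lambda>n. (K n)\<^sup>2) ` workers P)
       + pc3 P * \<gamma> / B
       + pc4 P * \<gamma> * (\<Sum>n\<in>workers P. pq P n * (K n)\<^sup>2) / (\<Sum>n\<in>workers P. K n)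
       \<le> pCmax P)"

definition objective_P :: "fl_params \<Rightarrow> (nat \<Rightarrow> real) \<times> real \<Rightarrow> real" where
  "objective_P P = (\<lambda>(K, B). energy_cost P K B)"

definition feasible_P' ::
  "fl_params \<Rightarrow> real \<Rightarrow> (nat \<Rightarrow> real) \<times> real \<times> real \<times> real \<Rightarrow> bool" where
  "feasible_P' P \<gamma> = (\<lambda>(K, B, T1, T2).
     K \<in> positive_vectors P \<and> 0 < B \<and> 0 < T1 \<and> 0 < T2 \<and>
     (\<forall>n\<in>workers P. pC P n / pF P n * K n * inverse T1 \<le> 1) \<and>
     (\<forall>n\<in>workers P. K n * inverse T2 \<le> 1) \<and>
     (pC P 0 / pF P 0 + Max ((\<lambda>n. pM P n / pr P n) ` workers P) + pM P 0 / pr P 0 + B * T1)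
       * (K 0 / pTmax P) \<le> 1 \<and>
     pc1 P / (\<gamma> * K 0 * (\<Sum>n\<in>workers P. K n))
       + pc2 P * \<gamma>\<^sup>2 * T2\<^sup>2
       + pc3 P * \<gamma> / B
       + pc4 P * \<gamma> * (\<Sum>n\<in>workers P. pq P n * (K n)\<^sup>2) / (\<Sum>n\<in>workers P. K n)
       \<le> pCmax P)"

definition objective_P' :: "fl_params \<Rightarrow> (nat \<Rightarrow> real) \<times> real \<times> real \<times> real \<Rightarrow> real" where
  "objective_P' P = (\<lambda>(K, B, T1, T2). energy_cost P K B)"

end

theory Submission
  imports Defs
begin

text \<open>
  The feasible set of (P) is the projection of that of (P') along \<open>(T\<^sub>1, T\<^sub>2)\<close>: the auxiliary
  variables bound the two maxima from above, and may be chosen equal to them. Since the objective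
  does not depend on \<open>(T\<^sub>1, T\<^sub>2)\<close>, minimizers project to minimizers.
\<close>

lemma mult_inverse_le_1_iff:
  fixes x y :: real
  assumes "0 < y"
  shows "x * inverse y \<le> 1 \<longleftrightarrow> x \<le> y"
  using assms by (simp add: inverse_eq_divide pos_divide_le_eq)

lemma finite_workers: "finite (workers P)"
  by (simp add: workers_def)

lemma workers_nonempty: "valid_params P \<Longrightarrow> workers P \<noteq> {}"
  by (simp add: workers_def valid_params_def)

lemma workers_subset_nodes: "workers P \<subseteq> nodes P"
  by (auto simp: workers_def nodes_def)

lemma positive_vectors_pos:
  "K \<in> positive_vectors P \<Longrightarrow> n \<in> nodes P \<Longrightarrow> 0 < K n"
  by (auto simp: positive_vectors_def PiE_iff)

text \<open>\<open>T1\<close> and \<open>T2\<close> dominate the maxima they replace, and both sides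
  to be bounded are nondecreasing in those maxima: the time cost because \<open>K 0\<close> and
  \<open>B\<close> are positive, the convergence bound because its second coefficient is
  nonnegative.\<close>

lemma feasible_P'_imp_feasible_P:
  assumes P: "valid_params P" and feas: "feasible_P' P \<gamma> (K, B, T1, T2)"
  shows "feasible_P P \<gamma> (K, B)"
proof -
  let ?W = "workers P"
  note W = finite_workers[of P] workers_nonempty[OF P]
  have K: "K \<in> positive_vectors P" and B: "0 < B" and T: "0 < T1" "0 < T2"
    and T1: "\<And>n. n \<in> ?W \<Longrightarrow> pC P n / pF P n * K n * inverse T1 \<le> 1"
    and T2: "\<And>n. n \<in> ?W \<Longrightarrow> K n * inverse T2 \<le> 1"
    and time: "(pC P 0 / pF P 0 + Max ((\<lambda>n. pM P n / pr P n) ` ?W) + pM P 0 / pr P 0 + B * T1)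
       * (K 0 / pTmax P) \<le> 1"
    and conv: "pc1 P / (\<gamma> * K 0 * (\<Sum>n\<in>?W. K n)) + pc2 P * \<gamma>\<^sup>2 * T2\<^sup>2 + pc3 P * \<gamma> / B
       + pc4 P * \<gamma> * (\<Sum>n\<in>?W. pq P n * (K n)\<^sup>2) / (\<Sum>n\<in>?W. K n) \<le> pCmax P"
    using feas by (auto simp: feasible_P'_def)
  have pos: "0 < K 0" "0 < pTmax P" "0 < pc2 P"
    using positive_vectors_pos[OF K, of 0] P by (auto simp: nodes_def valid_params_def)
  have "Max ((\<lambda>n. pC P n / pF P n * K n) ` ?W) \<le> T1"
  proof (subst Max_le_iff)
    show "\<forall>a\<in>(\<lambda>n. pC P n / pF P n * K n) ` ?W. a \<le> T1"
      using T1 unfolding mult_inverse_le_1_iff[OF T(1)] by blast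
  qed (use W in auto)
  then have "time_cost P K B \<le> K 0 * (B * T1 + pC P 0 / pF P 0
      + Max ((\<lambda>n. pM P n / pr P n) ` ?W) + pM P 0 / pr P 0)"
    unfolding time_cost_def using B pos(1)
    by (intro mult_left_mono add_right_mono) auto
  \<comment> \<open>This is the posynomial form of the time constraint, cleared of its denominator
    \<open>pTmax P > 0\<close>.\<close>
  also have "\<dots> \<le> pTmax P"
    using time pos(2) by (simp add: pos_divide_le_eq ac_simps)
  finally have time_le: "time_cost P K B \<le> pTmax P" .
  \<comment> \<open>Squaring preserves the bound by \<open>T2\<close> since the components of
    \<open>K\<close> are positive.\<close>
  have "(K n)\<^sup>2 \<le> T2\<^sup>2" if n: "n \<in> ?W" for n
  proof (rule power_mono)
    show "K n \<le> T2"
      using T2[OF n] unfolding mult_inverse_le_1_iff[OF T(2)] .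
    show "0 \<le> K n"
      using positive_vectors_pos[OF K, of n] n workers_subset_nodes[of P] by auto
  qed
  then have "Max ((\<lambda>n. (K n)\<^sup>2) ` ?W) \<le> T2\<^sup>2"
    using W by (subst Max_le_iff) auto
  then have "pc2 P * \<gamma>\<^sup>2 * Max ((\<lambda>n. (K n)\<^sup>2) ` ?W) \<le> pc2 P * \<gamma>\<^sup>2 * T2\<^sup>2"
    using pos(3) by (intro mult_left_mono) auto
  with conv show ?thesis
    using K B time_le by (simp add: feasible_P_def)
qed

text \<open>Choosing the maxima themselves as \<open>T1\<close> and \<open>T2\<close> makes the
  bounds on the workers automatic and adds nothing to the time cost or to the convergence
  bound.\<close>

lemma feasible_P_imp_feasible_P':
  assumes P: "valid_params P" and feas: "feasible_P P \<gamma> (K, B)"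
  shows "feasible_P' P \<gamma>
    (K, B, Max ((\<lambda>n. pC P n / pF P n * K n) ` workers P), Max (K ` workers P))"
proof -
  let ?W = "workers P"
  let ?f = "\<lambda>n. pC P n / pF P n * K n"
  note W = finite_workers[of P] workers_nonempty[OF P]
  have K: "K \<in> positive_vectors P" and B: "0 < B"
    and time: "time_cost P K B \<le> pTmax P"
    and conv: "pc1 P / (\<gamma> * K 0 * (\<Sum>n\<in>?W. K n)) + pc2 P * \<gamma>\<^sup>2 * Max ((\<lambda>n. (K n)\<^sup>2) ` ?W)
       + pc3 P * \<gamma> / B + pc4 P * \<gamma> * (\<Sum>n\<in>?W. pq P n * (K n)\<^sup>2) / (\<Sum>n\<in>?W. K n) \<le> pCmax P"
    using feas by (auto simp: feasible_P_def)
  have pos: "0 < pTmax P" "0 < pc2 P"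
    using P by (auto simp: valid_params_def)
  have Kpos: "0 < K n" and fpos: "0 < ?f n" if "n \<in> ?W" for n
    using positive_vectors_pos[OF K, of n] that workers_subset_nodes[of P] P
    by (auto simp: valid_params_def)
  have f_le: "?f n \<le> Max (?f ` ?W)" and K_le: "K n \<le> Max (K ` ?W)" if "n \<in> ?W" for n
    using W that by (auto intro: Max_ge)
  \<comment> \<open>Positivity of the auxiliary variables is itself a constraint of (P'), and it
    allows their inverses to be cleared below. It holds because there is at least one
    worker.\<close>
  have T: "0 < Max (?f ` ?W)" "0 < Max (K ` ?W)"
    using W Kpos fpos by (subst Max_gr_iff; auto)+
  \<comment> \<open>The square of the maximum must be compared with the maximum of the squares: the
    largest \<open>K n\<close> is attained at some worker \<open>m\<close>, so its square is one of
    those squares.\<close>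
  have "Max (K ` ?W) \<in> K ` ?W"
    using W by (intro Max_in) auto
  then obtain m where m: "m \<in> ?W" "Max (K ` ?W) = K m"
    by auto
  have "(Max (K ` ?W))\<^sup>2 \<le> Max ((\<lambda>n. (K n)\<^sup>2) ` ?W)"
    unfolding m(2) using W m(1) by (intro Max_ge) auto
  then have "pc2 P * \<gamma>\<^sup>2 * (Max (K ` ?W))\<^sup>2 \<le> pc2 P * \<gamma>\<^sup>2 * Max ((\<lambda>n. (K n)\<^sup>2) ` ?W)"
    using pos(2) by (intro mult_left_mono) auto
  moreover have "?f n * inverse (Max (?f ` ?W)) \<le> 1" if "n \<in> ?W" for n
    unfolding mult_inverse_le_1_iff[OF T(1)] using f_le[OF that] .
  moreover have "K n * inverse (Max (K ` ?W)) \<le> 1" if "n \<in> ?W" for n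
    unfolding mult_inverse_le_1_iff[OF T(2)] using K_le[OF that] .
  \<comment> \<open>For this \<open>T1\<close> the left-hand side is exactly
    \<open>time_cost P K B / pTmax P\<close>.\<close>
  moreover have "(pC P 0 / pF P 0 + Max ((\<lambda>n. pM P n / pr P n) ` ?W) + pM P 0 / pr P 0
      + B * Max (?f ` ?W)) * (K 0 / pTmax P) \<le> 1"
    using time pos(1) by (simp add: time_cost_def pos_divide_le_eq ac_simps)
  ultimately show ?thesis
    using K B T conv unfolding feasible_P'_def by auto
qed

theorem theorem2:
  fixes P :: fl_params
    and \<gamma>C B T1 T2 :: real
    and K :: "nat \<Rightarrow> real"
  assumes "valid_params P"
    and "\<gamma>C \<in> {0<..1 / pL P}"
    and "is_arg_min (objective_P' P) (feasible_P' P \<gamma>C) (K, B, T1, T2)"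
  shows "is_arg_min (objective_P P) (feasible_P P \<gamma>C) (K, B)"
proof -
  have feas: "feasible_P' P \<gamma>C (K, B, T1, T2)"
    and le: "\<And>x. feasible_P' P \<gamma>C x \<Longrightarrow> objective_P' P (K, B, T1, T2) \<le> objective_P' P x"
    using assms(3) by (auto simp: is_arg_min_linorder)
  \<comment> \<open>Each competitor in (P) lifts to one in (P') with the same energy, so optimality
    in (P') applies to it.\<close>
  have "objective_P P (K, B) \<le> objective_P P (K', B')" if "feasible_P P \<gamma>C (K', B')" for K' B'
    using le[OF feasible_P_imp_feasible_P'[OF assms(1) that]]
    by (simp add: objective_P_def objective_P'_def)
  with feasible_P'_imp_feasible_P[OF assms(1) feas] show ?thesis
    by (auto simp: is_arg_min_linorder)
qed

end
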